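(* For all integers $n \geq 1$ and all real $x$, $$B_{n}(x) = x^n - n \sum_{m=1}^n \frac{c_{m}}{m} \genfrac{\{}{\}}{0pt}{}{n-1}{m-1}_x$$ and $$B_{n}(x) = (x-1)^n - n \sum_{m=1}^n \frac{\widehat{c}_{m}}{m} \genfrac{\{}{\}}{0pt}{}{n-1}{m-1}_x.$$
   Context: For real $z$ and integer $n\ge 0$, $\binom{z}{n} = \frac{z(z-1)\cdots(z-n+1)}{n!}$. The Cauchy numbers of the first and second kind are $c_n = n! \int_{0}^{1} \binom{t}{n}\, dt$ and $\widehat{c}_n = n! \int_{0}^{1} \binom{- t}{n}\, dt$, $n \ge 0$. $B_n(x)$ are the classical Bernoulli polynomials, $\frac{te^{xt}}{e^t-1}=\sum_{n\ge0}B_n(x)\frac{t^n}{n!}$. The generalized Stirling numbers of the second kind are $\genfrac{\{}{\}}{0pt}{}{n}{m}_x = \sum_{i=0}^{n-m} \binom{n}{i}\genfrac{\{}{\}}{0pt}{}{n-i}{m} x^i$ for $0 \leq m \leq n$ and $x\in\mathbb{R}$, where $\genfrac{\{}{\}}{0pt}{}{n}{m}$ are the ordinary Stirling numbers of the second kind and $x^0=1$. *)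

theory Defs
  imports
    "HOL-Analysis.Analysis"
    "HOL-Computational_Algebra.Formal_Power_Series"
    "HOL-Combinatorics.Stirling"
begin

definition cauchy_first :: "nat \<Rightarrow> real" where
  "cauchy_first n = fact n * integral {0..1} (\<lambda>t::real. t gchoose n)"

definition cauchy_second :: "nat \<Rightarrow> real" where
  "cauchy_second n = fact n * integral {0..1} (\<lambda>t::real. (- t) gchoose n)"

(* The numerator and the denominator both have zero constant term.  Since the denominator has
   subdegree 1, fps division is exact here; see bernoulli_poly_egf_mult below. *)
definition bernoulli_poly_egf :: "real \<Rightarrow> real fps" where
  "bernoulli_poly_egf x = fps_X * fps_exp x / (fps_exp 1 - 1)"

definition bernoulli_poly :: "nat \<Rightarrow> real \<Rightarrow> real" where
  "bernoulli_poly n x = fact n * fps_nth (bernoulli_poly_egf x) n"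

lemma bernoulli_poly_egf_mult:
  "bernoulli_poly_egf x * (fps_exp 1 - 1) = fps_X * fps_exp x"
proof -
  have nz: "fps_nth (fps_exp 1 - 1 :: real fps) 1 \<noteq> 0"
    by simp
  then have "subdegree (fps_exp 1 - 1 :: real fps) = 1"
    by (intro subdegreeI) auto
  moreover have "fps_exp 1 - 1 \<noteq> (0 :: real fps)"
    using nz by (metis fps_zero_nth)
  moreover have "fps_exp x \<noteq> 0"
    by (metis fps_exp_nth fps_zero_nth power_0 fact_0 of_nat_1 div_by_1 zero_neq_one)
  then have "subdegree (fps_X * fps_exp x) \<ge> 1"
    by simp
  ultimately have "(fps_exp 1 - 1 :: real fps) dvd fps_X * fps_exp x"
    by (subst fps_dvd_iff) auto
  then show ?thesis
    unfolding bernoulli_poly_egf_def by simp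
qed

lemma bernoulli_poly_egf_eq:
  "bernoulli_poly_egf x = Abs_fps (\<lambda>n. bernoulli_poly n x / fact n)"
  by (simp add: fps_eq_iff bernoulli_poly_def)

(* Intended for m \<le> n, so that the subtraction on nat is exact; for m > n the value is 0. *)
definition gen_Stirling :: "nat \<Rightarrow> nat \<Rightarrow> real \<Rightarrow> real" where
  "gen_Stirling n m x =
     (\<Sum>i=0..n - m. of_nat (n choose i) * of_nat (Stirling (n - i) m) * x ^ i)"

end

theory Submission
  imports Defs
begin

text \<open>
  For every real \<open>y\<close>, put \<open>a m = m! \<integral> (t choose m) dt\<close>, the integral taken over \<open>[y, y+1]\<close>.
  Expanding powers in falling factorials and integrating gives
  \<open>\<Sum>m\<le>k. S(k,m) a m = \<integral> t^k dt\<close>; with \<open>u = e^T - 1\<close>, whose powers generate the Stirling numbers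
  of the second kind, this says \<open>T * (\<Sum>m. a m u^m / m!) = u e^(yT)\<close>. Since \<open>a 0 = 1\<close>, splitting
  off the term \<open>m = 0\<close> and multiplying by \<open>e^(xT) / u\<close> yields
  \<open>T e^(xT) / u = e^((x+y)T) - T e^(xT) (\<Sum>m\<ge>1. a m u^(m-1) / m!)\<close>, and comparing coefficients
  gives a formula for the Bernoulli polynomial. The Cauchy numbers of the first and the second kind
  are the cases \<open>y = 0\<close> and \<open>y = -1\<close>.
\<close>

text \<open>With \<open>g m\<close> the falling factorial,
  \<open>s * g m = m * g m + g (m + 1)\<close>; this matches the Stirling recurrence.\<close>

lemma power_eq_sum_Stirling_gbinomial:
  fixes s :: "'a::field_char_0"
  shows "s ^ k = (\<Sum>m\<le>k. of_nat (Stirling k m) * (fact m * (s gchoose m)))"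
proof (induction k)
  case 0
  then show ?case by simp
next
  case (Suc k)
  define g where "g m = fact m * (s gchoose m)" for m
  have step: "s * g m = of_nat m * g m + g (Suc m)" for m
    unfolding g_def mult.left_commute[of s] gbinomial_mult_1 by (simp add: algebra_simps)
  \<comment> \<open>Both boundary terms vanish: \<open>m = 0\<close> by the factor \<open>m\<close>,
    and \<open>m = k + 1\<close> because \<open>Stirling k (k + 1) = 0\<close>.\<close>
  have shift: "(\<Sum>m\<le>k. of_nat (Suc m * Stirling k (Suc m)) * g (Suc m))
      = (\<Sum>m\<le>k. of_nat (m * Stirling k m) * g m)"
  proof -
    have "(\<Sum>m\<le>Suc k. of_nat (m * Stirling k m) * g m)
        = (\<Sum>m\<le>k. of_nat (Suc m * Stirling k (Suc m)) * g (Suc m))"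
      by (subst sum.atMost_Suc_shift) simp
    then show ?thesis by simp
  qed
  have "s ^ Suc k = (\<Sum>m\<le>k. of_nat (Stirling k m) * (s * g m))"
    using Suc.IH by (simp add: g_def sum_distrib_left mult_ac)
  also have "\<dots> = (\<Sum>m\<le>k. of_nat (m * Stirling k m) * g m)
      + (\<Sum>m\<le>k. of_nat (Stirling k m) * g (Suc m))"
    by (simp add: step algebra_simps sum.distrib)
  also have "\<dots> = (\<Sum>m\<le>k. of_nat (Stirling (Suc k) (Suc m)) * g (Suc m))"
    unfolding shift[symmetric] by (simp add: algebra_simps sum.distrib)
  also have "\<dots> = (\<Sum>m\<le>Suc k. of_nat (Stirling (Suc k) m) * g m)"
    by (subst sum.atMost_Suc_shift) simp
  finally show ?case by (simp add: g_def)
qed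

text \<open>For \<open>u = e^T - 1\<close> one has \<open>u' = u + 1\<close>, so
  \<open>(u^m)' = m (u^m + u^(m-1))\<close>, which is the Stirling recurrence on
  coefficients.\<close>

lemma fps_nth_exp_minus_one_power:
  "fps_nth ((fps_exp 1 - 1 :: 'a::field_char_0 fps) ^ m) k
     = fact m * of_nat (Stirling k m) / fact k"
proof (induction k arbitrary: m)
  case 0
  then show ?case by (cases m) (simp_all add: fps_nth_power_0)
next
  case (Suc k)
  show ?case
  proof (cases m)
    case 0
    then show ?thesis by simp
  next
    case (Suc j)
    let ?u = "fps_exp 1 - 1 :: 'a fps"
    have du: "fps_deriv ?u = fps_exp 1"
      by simp
    have "fps_deriv (?u ^ m) = of_nat m * (?u ^ m + ?u ^ j)"
      unfolding Suc fps_deriv_power' du by (simp only: diff_Suc_1 power_Suc) (simp add: algebra_simps)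
    then have "of_nat (Suc k) * fps_nth (?u ^ m) (Suc k)
        = of_nat m * (fps_nth (?u ^ m) k + fps_nth (?u ^ j) k)"
      by (metis fps_deriv_nth fps_mult_of_nat_nth(1) fps_add_nth Suc_eq_plus1)
    also have "\<dots> = fact m * of_nat (Stirling (Suc k) m) / fact k"
      unfolding Suc.IH by (simp add: Suc field_simps)
    finally show ?thesis
      by (simp add: field_simps del: of_nat_Suc)
  qed
qed

lemma gen_Stirling_eq_fps_nth:
  "gen_Stirling n m x
     = fact n / fact m * fps_nth (fps_exp x * (fps_exp 1 - 1) ^ m) n"
proof -
  have "gen_Stirling n m x
      = (\<Sum>i=0..n. of_nat (n choose i) * of_nat (Stirling (n - i) m) * x ^ i)"
    \<comment> \<open>The added terms have \<open>n - i < m\<close>, so their Stirling numbers are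
      zero.\<close>
    unfolding gen_Stirling_def by (rule sum.mono_neutral_left) auto
  also have "\<dots> = (\<Sum>i=0..n. fact n / fact m *
      (fps_nth (fps_exp x) i * fps_nth ((fps_exp 1 - 1) ^ m) (n - i)))"
    by (rule sum.cong) (simp_all add: fps_nth_exp_minus_one_power binomial_fact field_simps)
  finally show ?thesis by (simp add: fps_mult_nth sum_distrib_left)
qed

lemma sum_Stirling_integral_gbinomial:
  fixes y :: real
  shows "(\<Sum>m\<le>k. of_nat (Stirling k m) * (fact m * integral {y..y+1} (\<lambda>t. t gchoose m)))
           = ((y + 1) ^ Suc k - y ^ Suc k) / of_nat (Suc k)"
proof -
  have int: "(\<lambda>t::real. t gchoose m) integrable_on {y..y+1}" for m
    unfolding gbinomial_prod_rev by (intro integrable_continuous_real continuous_intros) auto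
  have "((\<lambda>t. t ^ k) has_integral
      (\<Sum>m\<le>k. of_nat (Stirling k m) * (fact m * integral {y..y+1} (\<lambda>t. t gchoose m)))) {y..y+1}"
    unfolding power_eq_sum_Stirling_gbinomial
    by (intro has_integral_sum has_integral_mult_right integrable_integral int) simp
  moreover have "((\<lambda>t. t ^ k) has_integral
      ((y + 1) ^ Suc k / of_nat (Suc k) - y ^ Suc k / of_nat (Suc k))) {y..y+1}"
    by (rule fundamental_theorem_of_calculus)
      (auto intro!: DERIV_cong[OF DERIV_cdivide[OF DERIV_pow]]
        simp flip: has_real_derivative_iff_has_vector_derivative simp del: of_nat_Suc power_Suc)
  ultimately show ?thesis
    by (metis has_integral_unique diff_divide_distrib)
qed

lemma bernoulli_poly_eq_sum_integral_gbinomial: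
  fixes x y :: real
  assumes "n \<ge> 1"
    and a: "\<And>m. a m = fact m * integral {y..y+1} (\<lambda>t. t gchoose m)"
  shows "bernoulli_poly n x
           = (x + y) ^ n - of_nat n * (\<Sum>m=1..n. a m / of_nat m * gen_Stirling (n - 1) (m - 1) x)"
proof -
  let ?u = "fps_exp 1 - 1 :: real fps"
  define A where "A = Abs_fps (\<lambda>m. a m / fact m)"
  define D where "D = Abs_fps (\<lambda>m. a (Suc m) / fact (Suc m))"
  have u0: "fps_nth ?u 0 = 0" by simp
  \<comment> \<open>The constant term is \<open>a 0 = 1\<close>, the length of the interval.\<close>
  have A: "A = 1 + fps_X * D"
  proof (rule fps_ext)
    fix k
    show "fps_nth A k = fps_nth (1 + fps_X * D) k"
      by (cases k) (simp_all add: A_def D_def a)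
  qed
  have AU: "fps_X * (A oo ?u) = ?u * fps_exp y"
  proof (rule fps_ext)
    fix k
    show "fps_nth (fps_X * (A oo ?u)) k = fps_nth (?u * fps_exp y) k"
    proof (cases k)
      case 0
      then show ?thesis by simp
    next
      case (Suc j)
      have "fps_nth (A oo ?u) j = (\<Sum>m\<le>j. of_nat (Stirling j m) * a m) / fact j"
        by (simp add: fps_compose_nth A_def fps_nth_exp_minus_one_power sum_divide_distrib
            atLeast0AtMost mult_ac)
      also have "\<dots> = ((y + 1) ^ Suc j - y ^ Suc j) / fact (Suc j)"
        unfolding a sum_Stirling_integral_gbinomial by (simp add: field_simps)
      finally show ?thesis
        by (simp add: Suc algebra_simps diff_divide_distrib flip: fps_exp_add_mult)
    qed
  qed
  have unz: "?u \<noteq> 0"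
    by (rule fps_nonzeroI[of _ 1]) simp
  have "A oo ?u = 1 + ?u * (D oo ?u)"
    unfolding A by (simp add: fps_compose_add_distrib fps_compose_mult_distrib[OF u0] u0)
  then have "fps_X * (1 + ?u * (D oo ?u)) = ?u * fps_exp y"
    using AU by simp
  then have "fps_X * (D oo ?u) * ?u = ?u * fps_exp y - fps_X"
    by (simp add: algebra_simps)
  then have "(fps_exp x * fps_exp y - fps_X * fps_exp x * (D oo ?u)) * ?u = fps_X * fps_exp x"
    by algebra
  \<comment> \<open>The series \<open>u\<close> has zero constant term and hence no inverse; it is
    cancelled as a nonzero factor instead.\<close>
  then have "bernoulli_poly_egf x = fps_exp (x + y) - fps_X * (fps_exp x * (D oo ?u))"
    using bernoulli_poly_egf_mult[of x] unz
    by (metis fps_exp_add_mult mult.assoc mult_right_cancel)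
  then have B: "bernoulli_poly n x = (x + y) ^ n - fact n * fps_nth (fps_exp x * (D oo ?u)) (n - 1)"
    using \<open>n \<ge> 1\<close> by (simp add: bernoulli_poly_def right_diff_distrib)
  obtain N where n: "n = Suc N" using \<open>n \<ge> 1\<close> by (cases n) auto
  \<comment> \<open>The powers \<open>u^m\<close> with \<open>m > N - i\<close> contribute nothing,
    so the inner range can be made independent of \<open>i\<close> and the sums swapped.\<close>
  have "fps_nth (fps_exp x * (D oo ?u)) N
      = (\<Sum>i=0..N. fps_nth (fps_exp x) i
          * (\<Sum>m=0..N. fps_nth D m * fps_nth (?u ^ m) (N - i)))"
    unfolding fps_mult_nth fps_compose_nth
    by (intro sum.cong refl arg_cong2[where f = "(*)"] sum.mono_neutral_left)
      (auto simp: fps_nth_exp_minus_one_power)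
  also have "\<dots> = (\<Sum>m=0..N. fps_nth D m * fps_nth (fps_exp x * ?u ^ m) N)"
    unfolding fps_mult_nth sum_distrib_left by (subst sum.swap) (simp add: mult_ac)
  \<comment> \<open>The quotient \<open>m! / (m + 1)!\<close> leaves the denominator
    \<open>m + 1\<close>.\<close>
  also have "\<dots> = (\<Sum>m=0..N. a (Suc m) / of_nat (Suc m) * gen_Stirling N m x) / fact N"
    by (simp add: D_def gen_Stirling_eq_fps_nth sum_divide_distrib mult_ac)
  also have "\<dots> = (\<Sum>m=1..n. a m / of_nat m * gen_Stirling N (m - 1) x) / fact N"
    unfolding n One_nat_def by (subst sum.shift_bounds_cl_Suc_ivl) simp
  finally show ?thesis
    using B by (simp add: n)
qed

theorem theorem8:
  fixes n :: nat and x :: real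
  assumes "n \<ge> 1"
  shows "bernoulli_poly n x =
           x ^ n - of_nat n * (\<Sum>m=1..n. cauchy_first m / of_nat m * gen_Stirling (n - 1) (m - 1) x)
       \<and> bernoulli_poly n x =
           (x - 1) ^ n - of_nat n * (\<Sum>m=1..n. cauchy_second m / of_nat m * gen_Stirling (n - 1) (m - 1) x)"
proof -
  have "cauchy_first m = fact m * integral {0..0+1} (\<lambda>t. t gchoose m)" for m
    by (simp add: cauchy_first_def)
  \<comment> \<open>The reflection of \<open>t\<close> to \<open>-t\<close> carries
    \<open>[0, 1]\<close> to \<open>[-1, 0]\<close>.\<close>
  moreover have "cauchy_second m = fact m * integral {-1..-1+1} (\<lambda>t. t gchoose m)" for m
    using Henstock_Kurzweil_Integration.integral_reflect_real[of 1 0 "\<lambda>t. (- t) gchoose m"]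
    by (simp add: cauchy_second_def)
  ultimately show ?thesis
    using bernoulli_poly_eq_sum_integral_gbinomial[OF assms, of cauchy_first 0 x]
      bernoulli_poly_eq_sum_integral_gbinomial[OF assms, of cauchy_second "-1" x]
    by simp
qed

end
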